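(* Let $m,n$ be positive integers with $n\geq 2m+1$, let $W_n^m$ be the web graph on $n$ vertices with parameter $m$, and let $k$ be a positive integer with $k\leq 2m+1$. Then $$\gamma_{\times k}(W_n^m)=\left\lceil \frac{kn}{2m+1}\right\rceil .$$
   Context: Web graph: for positive integers $m\geq 1$ and $n\geq 2m+1$, $W_n^m$ has vertex set $\{v_1,\dots,v_n\}$, and $v_iv_j$ is an edge if and only if $j\equiv i\pm l \pmod n$ for some $l\in\{1,\dots,m\}$. Every closed neighborhood has exactly $2m+1$ vertices. For a graph $G$, the closed neighborhood of $v$ is $N_G[v]=\{v\}\cup\{u: uv\in E(G)\}$. For a non-negative integer $k$, a set $D\subseteq V(G)$ is a $k$-tuple dominating set of $G$ if $|N_G[v]\cap D|\geq k$ for every $v\in V(G)$. The $k$-tuple domination number $\gamma_{\times k}(G)$ is the minimum cardinality of a $k$-tuple dominating set of $G$ (and $+\infty$ if none exists, i.e. if $k>\delta(G)+1$). *)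

theory Defs
  imports Complex_Main "HOL-Library.Extended_Nat" "HOL-Number_Theory.Cong"
    "Graph_Theory.Pair_Digraph"
begin

text \<open>
  Graphs are finite, simple and undirected, i.e. the locale \<^locale>\<open>graph\<close> (symmetric loop-free
  digraphs). The definitions below are meant for such graphs only: cardinalities are taken with
  \<^const>\<open>card\<close>, which is 0 on infinite sets.
\<close>

definition closed_neighborhood :: "('a, 'b) pre_digraph \<Rightarrow> 'a \<Rightarrow> 'a set" where
  "closed_neighborhood G v = {v} \<union> {u. u \<rightarrow>\<^bsub>G\<^esub> v}"

definition tuple_dominating :: "nat \<Rightarrow> ('a, 'b) pre_digraph \<Rightarrow> 'a set \<Rightarrow> bool" where
  "tuple_dominating k G D \<longleftrightarrow>
     D \<subseteq> verts G \<and> (\<forall>v \<in> verts G. k \<le> card (closed_neighborhood G v \<inter> D))"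

text \<open>
  The infimum in \<^typ>\<open>enat\<close> is \<open>\<infinity>\<close> on the empty set and is a minimum otherwise.
\<close>

definition tuple_domination_number :: "nat \<Rightarrow> ('a, 'b) pre_digraph \<Rightarrow> enat" where
  "tuple_domination_number k G = Inf {enat (card D) | D. tuple_dominating k G D}"

lemma tuple_domination_number_infinity:
  assumes "\<nexists>D. tuple_dominating k G D"
  shows "tuple_domination_number k G = \<infinity>"
  using assms by (simp add: tuple_domination_number_def Inf_enat_def)

lemma tuple_domination_number_attained:
  assumes "tuple_dominating k G D"
  shows "\<exists>D'. tuple_dominating k G D' \<and> tuple_domination_number k G = enat (card D')"
proof -
  let ?S = "{enat (card D) | D. tuple_dominating k G D}"
  have "enat (card D) \<in> ?S" using assms by blast
  then have "Inf ?S \<in> ?S" unfolding Inf_enat_def by (auto intro: LeastI)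
  then show ?thesis unfolding tuple_domination_number_def by auto
qed

text \<open>
  The vertex \<open>v\<^sub>i\<close> is represented by its index \<open>i\<close>. Congruences are over the integers,
  since subtraction on \<^typ>\<open>nat\<close> truncates.
\<close>

definition web_graph :: "nat \<Rightarrow> nat \<Rightarrow> nat pair_pre_digraph" where
  "web_graph n m = \<lparr> pverts = {1..n},
     parcs = {(i, j). i \<in> {1..n} \<and> j \<in> {1..n} \<and>
       (\<exists>l \<in> {1..m}. [int j = int i + int l] (mod int n) \<or> [int j = int i - int l] (mod int n))} \<rparr>"

lemma graph_web_graph:
  assumes "2 * m + 1 \<le> n"
  shows "graph (with_proj (web_graph n m))"
proof -
  let ?G = "with_proj (web_graph n m)"
  have A: "arcs ?G \<subseteq> {1..n} \<times> {1..n}" by (auto simp: web_graph_def)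
  have sym: "symmetric ?G"
    unfolding symmetric_def sym_def
  proof (intro allI impI)
    fix i j assume "(i, j) \<in> arcs_ends ?G"
    then obtain l where l: "i \<in> {1..n}" "j \<in> {1..n}" "l \<in> {1..m}"
      "[int j = int i + int l] (mod int n) \<or> [int j = int i - int l] (mod int n)"
      by (auto simp: web_graph_def)
    from l(4) have "[int i = int j + int l] (mod int n) \<or> [int i = int j - int l] (mod int n)"
    proof
      assume "[int j = int i + int l] (mod int n)"
      from cong_diff[OF cong_sym[OF this] cong_refl[of "int l"]]
      show ?thesis by simp
    next
      assume "[int j = int i - int l] (mod int n)"
      from cong_add[OF cong_sym[OF this] cong_refl[of "int l"]]
      show ?thesis by simp
    qed
    with l(1-3) show "(j, i) \<in> arcs_ends ?G" unfolding web_graph_def by auto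
  qed
  have loop: "fst e \<noteq> snd e" if "e \<in> arcs ?G" for e
  proof
    assume "fst e = snd e"
    moreover obtain i j where e: "e = (i, j)" by (cases e)
    ultimately have "(i, i) \<in> arcs ?G" using that by simp
    then obtain l where l: "l \<in> {1..m}"
      "[int i = int i + int l] (mod int n) \<or> [int i = int i - int l] (mod int n)"
      unfolding web_graph_def with_proj_def by auto
    from l(2) have "int n dvd int l" by (simp only: cong_iff_dvd_diff) simp
    then have "n dvd l" by (simp only: int_dvd_int_iff)
    then have "n \<le> l" using l(1) by (intro dvd_imp_le) simp_all
    with l(1) assms show False by simp
  qed
  have fin: "finite (arcs ?G)" using A by (rule finite_subset) auto
  show ?thesis
  proof unfold_locales
    fix e assume "e \<in> arcs ?G"
    with A have "e \<in> {1..n} \<times> {1..n}" by blast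
    then show "tail ?G e \<in> verts ?G" and "head ?G e \<in> verts ?G"
      by (simp_all add: with_proj_def web_graph_def mem_Times_iff)
  next
    show "finite (verts ?G)" by (simp add: web_graph_def)
    show "finite (arcs ?G)" by (fact fin)
    show "symmetric ?G" by (fact sym)
  next
    fix e assume "e \<in> arcs ?G"
    then show "tail ?G e \<noteq> head ?G e" using loop by (simp add: with_proj_def)
  next
    fix e1 e2 assume "arc_to_ends ?G e1 = arc_to_ends ?G e2"
    then show "e1 = e2" by (simp add: arc_to_ends_def prod_eq_iff)
  qed
qed

end

theory Submission
  imports Defs
begin

text \<open>
  A closed neighborhood of the web graph is a cyclic window of \<open>2 * m + 1\<close> consecutive indices.
  Double counting the pairs \<open>(v, d)\<close> with \<open>d \<in> D\<close> in the closed neighborhood of \<open>v\<close>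
  gives the lower bound. For the upper bound, \<open>s = \<lceil>k * n / (2 * m + 1)\<rceil>\<close> elements are spread evenly
  over the cycle: take the indices at which \<open>\<lfloor>x * s / n\<rfloor>\<close> jumps. The number of jumps
  in a window telescopes to \<open>\<lfloor>(a + 2 * m + 1) * s / n\<rfloor> - \<lfloor>a * s / n\<rfloor>\<close>, which is at least
  \<open>\<lfloor>(2 * m + 1) * s / n\<rfloor> \<ge> k\<close>.
\<close>

lemma (in graph) tuple_dominating_double_count:
  assumes D: "tuple_dominating k G D"
    and w: "\<And>v. v \<in> verts G \<Longrightarrow> card (closed_neighborhood G v) \<le> w"
  shows "k * card (verts G) \<le> w * card D"
proof -
  let ?N = "closed_neighborhood G"
  have DV: "D \<subseteq> verts G" using D by (simp add: tuple_dominating_def)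
  have finD: "finite D" using DV finite_verts by (rule finite_subset)
  have adj: "u \<rightarrow>\<^bsub>G\<^esub> v \<longleftrightarrow> v \<rightarrow>\<^bsub>G\<^esub> u" for u v
    using sym_arcs by (auto simp: symmetric_def dest: symD)
  have N_sub: "?N v \<subseteq> verts G" if "v \<in> verts G" for v
    using that by (auto simp: closed_neighborhood_def)
  have "k * card (verts G) = (\<Sum>v\<in>verts G. k)" by simp
  also have "\<dots> \<le> (\<Sum>v\<in>verts G. card {d\<in>D. d \<in> ?N v})"
    using D by (intro sum_mono) (simp add: tuple_dominating_def Int_def conj_commute)
  also have "\<dots> = (\<Sum>d\<in>D. card {v\<in>verts G. d \<in> ?N v})"
    by (rule sum_multicount_gen[of "verts G" D "\<lambda>v d. d \<in> ?N v"]) (auto simp: finD)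
  also have "\<dots> \<le> (\<Sum>d\<in>D. w)"
  proof (rule sum_mono)
    fix d assume "d \<in> D"
    with DV have d: "d \<in> verts G" by blast
    \<comment> \<open>Adjacency is symmetric, so \<open>v\<close> lies in the closed neighborhood of
      \<open>d\<close> whenever \<open>d\<close> lies in that of \<open>v\<close>. Hence
      \<open>w\<close> also bounds how often \<open>d\<close> is counted.\<close>
    have "{v\<in>verts G. d \<in> ?N v} \<subseteq> ?N d"
      using adj by (auto simp: closed_neighborhood_def)
    then have "card {v\<in>verts G. d \<in> ?N v} \<le> card (?N d)"
      using finite_subset[OF N_sub[OF d] finite_verts] by (rule card_mono[rotated])
    with w[OF d] show "card {v\<in>verts G. d \<in> ?N v} \<le> w" by linarith
  qed
  finally show ?thesis by (simp add: mult.commute)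
qed

text \<open>The representative of \<open>x\<close> modulo \<open>n\<close> in \<open>{1..n}\<close>.
  The shift by 1 sends multiples of \<open>n\<close> to \<open>n\<close> instead of 0. Integer
  arguments let a window run past either end of the vertex range before it is wrapped.\<close>

definition web_index :: "nat \<Rightarrow> int \<Rightarrow> nat" where
  "web_index n x = nat ((x - 1) mod int n) + 1"

lemma web_index_eq_iff:
  assumes "n > 0"
  shows "web_index n x = u \<longleftrightarrow> u \<in> {1..n} \<and> [int u = x] (mod int n)"
proof -
  have *: "[int u = x] (mod int n) \<longleftrightarrow> int u - 1 = (x - 1) mod int n" if "u \<in> {1..n}"
  proof -
    have "[int u = x] (mod int n) \<longleftrightarrow> [int u - 1 = x - 1] (mod int n)"
      by (simp add: cong_iff_dvd_diff)
    also have "\<dots> \<longleftrightarrow> int u - 1 = (x - 1) mod int n"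
      using that by (auto simp: cong_def)
    finally show ?thesis .
  qed
  have "0 \<le> (x - 1) mod int n" "(x - 1) mod int n < int n" using assms by simp_all
  with * show ?thesis unfolding web_index_def by auto
qed

lemma closed_neighborhood_web_graph:
  assumes "2 * m + 1 \<le> n" and v: "v \<in> {1..n}"
  shows "closed_neighborhood (with_proj (web_graph n m)) v =
    web_index n ` {int v - int m..int v + int m}" (is "?N = ?R")
proof (intro set_eqI iffI)
  have n: "n > 0" using assms by simp
  fix u
  show "u \<in> ?R" if "u \<in> ?N"
  proof (cases "u = v")
    case True
    then have "web_index n (int v) = u" using v n by (simp add: web_index_eq_iff)
    then show ?thesis by (intro image_eqI[of _ _ "int v"]) auto
  next
    case False
    with that obtain l where l: "u \<in> {1..n}" "l \<in> {1..m}"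
      "[int v = int u + int l] (mod int n) \<or> [int v = int u - int l] (mod int n)"
      unfolding closed_neighborhood_def web_graph_def by auto
    from l(3) have "[int u = int v - int l] (mod int n) \<or> [int u = int v + int l] (mod int n)"
      by (auto simp: cong_iff_dvd_diff dvd_diff_commute algebra_simps)
    then have "u = web_index n (int v - int l) \<or> u = web_index n (int v + int l)"
      using l(1) n web_index_eq_iff by metis
    then show ?thesis using l(2) by auto
  qed
  show "u \<in> ?N" if "u \<in> ?R"
  proof -
    from that obtain x where x: "x \<in> {int v - int m..int v + int m}" "web_index n x = u" by auto
    then have u: "u \<in> {1..n}" "[int u = x] (mod int n)" using web_index_eq_iff[OF n] by auto
    \<comment> \<open>The distance from \<open>v\<close> in the unwrapped window: at most
      \<open>m\<close>, and at least 1 once \<open>x = int v\<close> is excluded.\<close>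
    define l where "l = nat \<bar>x - int v\<bar>"
    consider "x = int v" | "x > int v" | "x < int v" by linarith
    then show ?thesis
    proof cases
      case 1
      then have "web_index n x = v" using v n by (simp add: web_index_eq_iff)
      with x show ?thesis by (simp add: closed_neighborhood_def)
    next
      case 2
      then have "l \<in> {1..m}" "[int v = int u - int l] (mod int n)"
        using x u by (auto simp: l_def cong_iff_dvd_diff dvd_diff_commute algebra_simps)
      then show ?thesis using u(1) v
        unfolding closed_neighborhood_def web_graph_def by auto
    next
      case 3
      then have "l \<in> {1..m}" "[int v = int u + int l] (mod int n)"
        using x u by (auto simp: l_def cong_iff_dvd_diff dvd_diff_commute algebra_simps)
      then show ?thesis using u(1) v
        unfolding closed_neighborhood_def web_graph_def by auto
    qed
  qed
qed

text \<open>Two members of a window differ by at most \<open>2 * m\<close>, which is less than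
  \<open>n\<close>, so congruent ones coincide.\<close>

lemma inj_on_web_index:
  assumes "2 * m + 1 \<le> n"
  shows "inj_on (web_index n) {a - int m..a + int m}"
proof (rule inj_onI)
  fix x y assume x: "x \<in> {a - int m..a + int m}" and y: "y \<in> {a - int m..a + int m}"
    and eq: "web_index n x = web_index n y"
  have n: "n > 0" using assms by simp
  have "[x = y] (mod int n)"
    using web_index_eq_iff[OF n] eq by (metis cong_sym cong_trans)
  then have "int n dvd x - y" by (simp add: cong_iff_dvd_diff)
  moreover have "\<bar>x - y\<bar> < int n" using x y assms by auto
  ultimately show "x = y" using dvd_imp_le_int[of "x - y" "int n"] by force
qed

lemma card_closed_neighborhood_web_graph:
  assumes "2 * m + 1 \<le> n" and "v \<in> {1..n}"
  shows "card (closed_neighborhood (with_proj (web_graph n m)) v) = 2 * m + 1"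
  by (simp add: closed_neighborhood_web_graph[OF assms] card_image[OF inj_on_web_index[OF assms(1)]])

text \<open>The jump at \<open>x\<close> of the staircase \<open>x * s div n\<close>. The places of
  the jumps form the balanced (Sturmian-like) pattern of \<open>s\<close> points per period
  \<open>n\<close>.\<close>

definition div_step :: "int \<Rightarrow> int \<Rightarrow> int \<Rightarrow> int" where
  "div_step s n x = x * s div n - (x - 1) * s div n"

text \<open>One step adds \<open>s\<close>, between 0 and \<open>n\<close>, to the numerator, so the
  quotient grows by at most 1.\<close>

lemma div_step_01:
  assumes "0 \<le> s" "s \<le> n" "0 < n"
  shows "div_step s n x \<in> {0, 1}"
proof -
  have "(x - 1) * s div n \<le> x * s div n"
    using assms by (intro zdiv_mono1) (simp_all add: algebra_simps)
  moreover have "x * s div n \<le> ((x - 1) * s + n) div n"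
    using assms by (intro zdiv_mono1) (simp_all add: algebra_simps)
  moreover have "((x - 1) * s + n) div n = (x - 1) * s div n + 1"
    using assms by simp
  ultimately show ?thesis by (auto simp: div_step_def)
qed

text \<open>Shifting \<open>x\<close> by \<open>n * t\<close> adds the same integer
  \<open>t * s\<close> to both quotients. The pattern is thus well defined on the cycle.\<close>

lemma div_step_cong:
  assumes "[x = y] (mod n)" "n \<noteq> 0"
  shows "div_step s n x = div_step s n y"
proof -
  from assms(1) obtain t where x: "x = y + n * t"
    by (metis cong_iff_lin cong_sym)
  have "x * s = y * s + n * (t * s)" "(x - 1) * s = (y - 1) * s + n * (t * s)"
    by (simp_all add: x algebra_simps)
  then show ?thesis using assms(2) by (simp add: div_step_def)
qed

lemma card_div_step:
  assumes "0 \<le> s" "s \<le> n" "0 < n"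
  shows "int (card {x \<in> {a<..a + int w}. div_step s n x = 1}) =
    (a + int w) * s div n - a * s div n"
proof -
  have "int (card {x \<in> {a<..a + int w}. div_step s n x = 1}) =
      (\<Sum>x\<in>{a<..a + int w}. if div_step s n x = 1 then 1 else 0)"
    by (simp add: sum.If_cases Int_def)
  also have "\<dots> = (\<Sum>x\<in>{a<..a + int w}. div_step s n x)"
    using div_step_01[OF assms] by (intro sum.cong) auto
  also have "\<dots> = (a + int w) * s div n - a * s div n"
  proof (induction w)
    case (Suc w)
    have "{a<..a + int (Suc w)} = insert (a + int w + 1) {a<..a + int w}" by auto
    then show ?case using Suc by (simp add: div_step_def algebra_simps)
  qed simp
  finally show ?thesis .
qed

lemma tuple_dominating_web_graph:
  assumes mn: "2 * m + 1 \<le> n" and s: "s \<le> n" "k * n \<le> (2 * m + 1) * s"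
  shows "\<exists>D. tuple_dominating k (with_proj (web_graph n m)) D \<and> card D = s"
proof -
  let ?G = "with_proj (web_graph n m)"
  have n: "n > 0" using mn by simp
  have sn: "0 \<le> int s" "int s \<le> int n" "0 < int n" using s n by simp_all
  define D where "D = {u \<in> {1..n}. div_step (int s) (int n) (int u) = 1}"
  have "int (card D) = int (card (int ` D))" by (simp add: card_image)
  also have "int ` D = {x \<in> {0<..0 + int n}. div_step (int s) (int n) x = 1}"
  proof -
    have "x \<in> int ` D" if "x \<in> {0<..0 + int n}" "div_step (int s) (int n) x = 1" for x
      using that by (intro image_eqI[of _ _ "nat x"]) (auto simp: D_def)
    then show ?thesis by (auto simp: D_def)
  qed
  \<comment> \<open>Over one full period the count telescopes to
    \<open>n * s div n = s\<close>.\<close>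
  also have "int (card \<dots>) = int s" using n by (subst card_div_step[OF sn]) simp
  finally have cardD: "card D = s" by simp
  have "k \<le> card (closed_neighborhood ?G v \<inter> D)" if v: "v \<in> verts ?G" for v
  proof -
    have v': "v \<in> {1..n}" using v by (simp add: web_graph_def)
    \<comment> \<open>One below the left end of the window, since \<open>card_div_step\<close>
      counts over an interval open on the left.\<close>
    define a where "a = int v - int m - 1"
    have win: "{int v - int m..int v + int m} = {a<..a + int (2 * m + 1)}"
      by (auto simp: a_def)
    let ?J = "{x \<in> {a<..a + int (2 * m + 1)}. div_step (int s) (int n) x = 1}"
    \<comment> \<open>By periodicity, membership in \<open>D\<close> can be tested on the unwrapped
      integer, so no case split on wrap-around is needed.\<close>
    have "web_index n x \<in> D \<longleftrightarrow> div_step (int s) (int n) x = 1" for x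
    proof -
      have i: "web_index n x \<in> {1..n}" "[int (web_index n x) = x] (mod int n)"
        using web_index_eq_iff[OF n] by blast+
      show ?thesis using i(1) div_step_cong[OF i(2)] n by (simp add: D_def)
    qed
    then have "closed_neighborhood ?G v \<inter> D = web_index n ` ?J"
      unfolding closed_neighborhood_web_graph[OF mn v'] win by auto
    moreover have "inj_on (web_index n) ?J"
      by (rule inj_on_subset[OF inj_on_web_index[OF mn, of "int v"]]) (auto simp: win)
    ultimately have "int (card (closed_neighborhood ?G v \<inter> D)) =
        (a + int (2 * m + 1)) * int s div int n - a * int s div int n"
      by (simp only: card_image card_div_step[OF sn])
    moreover have "a * int s div int n + int k \<le> (a + int (2 * m + 1)) * int s div int n"
    proof -
      \<comment> \<open>Moving \<open>k\<close> inside the quotient as \<open>k * n\<close> leaves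
        only numerators to compare, which is the hypothesis on \<open>s\<close>.\<close>
      have "a * int s div int n + int k = (a * int s + int k * int n) div int n"
        using n by simp
      also have "\<dots> \<le> (a + int (2 * m + 1)) * int s div int n"
      proof (rule zdiv_mono1)
        have "int k * int n \<le> int (2 * m + 1) * int s"
          using s(2) by (simp only: of_nat_mult[symmetric] of_nat_le_iff)
        then show "a * int s + int k * int n \<le> (a + int (2 * m + 1)) * int s"
          by (simp only: distrib_right add_left_mono)
      qed (use n in simp)
      finally show ?thesis .
    qed
    ultimately show ?thesis by linarith
  qed
  then have "tuple_dominating k ?G D"
    by (auto simp: tuple_dominating_def D_def web_graph_def)
  with cardD show ?thesis by blast
qed

text \<open>Through this equivalence both bounds of the theorem become inequalities between natural
  numbers.\<close>

lemma nat_ceiling_divide_le_iff: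
  assumes "b > 0"
  shows "nat \<lceil>real a / real b\<rceil> \<le> c \<longleftrightarrow> a \<le> b * c"
proof -
  have "nat \<lceil>real a / real b\<rceil> \<le> c \<longleftrightarrow> real a / real b \<le> real c"
    by (simp add: nat_le_iff ceiling_le_iff)
  also have "\<dots> \<longleftrightarrow> real a \<le> real (b * c)"
    using assms by (simp add: divide_le_eq mult.commute)
  finally show ?thesis by (simp only: of_nat_le_iff)
qed

theorem theorem6p8:
  fixes m n k :: nat
  assumes "m \<ge> 1" and "n \<ge> 2 * m + 1" and "k \<ge> 1" and "k \<le> 2 * m + 1"
  shows "tuple_domination_number k (with_proj (web_graph n m)) =
    enat (nat \<lceil>real (k * n) / real (2 * m + 1)\<rceil>)"
proof -
  let ?G = "with_proj (web_graph n m)"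
  define s where "s = nat \<lceil>real (k * n) / real (2 * m + 1)\<rceil>"
  have s_le_iff: "s \<le> c \<longleftrightarrow> k * n \<le> (2 * m + 1) * c" for c
    unfolding s_def by (rule nat_ceiling_divide_le_iff) simp
  interpret graph ?G using assms(2) by (rule graph_web_graph)
  \<comment> \<open>The case \<open>c = n\<close>, where \<open>k \<le> 2 * m + 1\<close> enters;
    the next line is the case \<open>c = s\<close>.\<close>
  have "s \<le> n" using assms(4) by (simp only: s_le_iff mult_le_mono1)
  moreover have "k * n \<le> (2 * m + 1) * s" using s_le_iff by blast
  ultimately obtain D where D: "tuple_dominating k ?G D" "card D = s"
    using tuple_dominating_web_graph[OF assms(2)] by blast
  have "s \<le> card D'" if "tuple_dominating k ?G D'" for D'
    using tuple_dominating_double_count[OF that, of "2 * m + 1"]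
      card_closed_neighborhood_web_graph[OF assms(2)]
    by (simp add: s_le_iff web_graph_def)
  then have "tuple_domination_number k ?G = enat s"
    unfolding tuple_domination_number_def using D
    by (intro antisym Inf_lower Inf_greatest) auto
  then show ?thesis by (simp only: s_def)
qed

end
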